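(* Let $R=\mathbb{K}[x_1,\ldots,x_n]$ be a polynomial ring over a field $\mathbb{K}$ of prime characteristic $p>0$ and let $\mathfrak{m}=(x_1,\ldots,x_n)$. Let $\mathfrak{a}$ be a non-zero proper monomial ideal in $R$. Then $$\mathcal{C}^{\mathfrak{m}}(\mathfrak{a}^{\bullet})=\min\left\{\frac{v(x_1\cdots x_n)}{v(\mathfrak{a})}:v\in\mathrm{RV}(\mathfrak{a})\right\},$$ where $\mathrm{RV}(\mathfrak{a})$ denotes the set of Rees valuations of $\mathfrak{a}$. Moreover, $\mathcal{C}^{\mathfrak{m}}(\mathfrak{a}^{\bullet})$ is a rational number.
   Context: $\mathfrak{a}^\bullet=\{\mathfrak{a}^i\}_{i\ge 0}$; $\mathfrak{m}^{[p^e]}=(x_1^{p^e},\ldots,x_n^{p^e})$; $\nu_{\mathfrak{a}^\bullet}^{\mathfrak{m}}(p^e)=\max\{r\in\mathbb{Z}_{\ge 0}:\mathfrak{a}^r\not\subseteq\mathfrak{m}^{[p^e]}\}$; $\mathcal{C}^{\mathfrak{m}}(\mathfrak{a}^\bullet)=\lim_{e\to\infty}\nu_{\mathfrak{a}^\bullet}^{\mathfrak{m}}(p^e)/p^e$ (the limit exists). Let $K$ be the fraction field of $R$. A set of Rees valuation domains of an ideal $\mathfrak{a}$ is a set $\{V_1,\ldots,V_s\}$ of Noetherian valuation domains, not fields, with $R\subseteq V_i\subseteq K$, such that the integral closure $\overline{\mathfrak{a}^m}$ equals $\bigcap_{i=1}^s(\mathfrak{a}^mV_i)\cap R$ for all $m\in\mathbb{N}$,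 and which is minimal with these properties; it is unique up to equivalence, and the corresponding valuations are the Rees valuations of $\mathfrak{a}$. For an ideal $J$, $v(J)=\min\{v(f):f\in J\setminus\{0\}\}$. *)

theory Defs
  imports Complex_Main "HOL-Algebra.Algebra" "HOL-Algebra.Algebraic_Closure_Type"
    "HOL-Library.Poly_Mapping" "HOL-Computational_Algebra.Computational_Algebra"
begin

text \<open>
  The polynomial ring in variables indexed by a finite type \<open>'n\<close> is the type
  \<open>('n \<Rightarrow>\<^sub>0 nat) \<Rightarrow>\<^sub>0 'k\<close>, and its fraction field is the type of fractions over it.
  The linear order on \<open>'n\<close> (that is, the numbering of the variables) is there because
  the library's integral domain instance for this type requires it.
\<close>

type_synonym ('n, 'k) mvpoly = "('n \<Rightarrow>\<^sub>0 nat) \<Rightarrow>\<^sub>0 'k"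

abbreviation type_ring :: "'a::comm_ring_1 ring" where
  "type_ring \<equiv> ring_of_type_algebra"

abbreviation ideal_power :: "'a::comm_ring_1 set \<Rightarrow> nat \<Rightarrow> 'a set" where
  "ideal_power I r \<equiv> I [^]\<^bsub>ideals_set type_ring\<^esub> r"


subsection \<open>Monomial ideals and the F-threshold\<close>

definition monomial :: "('n \<Rightarrow>\<^sub>0 nat) \<Rightarrow> ('n, 'k::field) mvpoly" where
  "monomial u = Poly_Mapping.single u 1"

definition var :: "'n \<Rightarrow> ('n, 'k::field) mvpoly" where
  "var i = monomial (Poly_Mapping.single i 1)"

definition monomial_ideal :: "('n, 'k::field) mvpoly set \<Rightarrow> bool" where
  "monomial_ideal I \<longleftrightarrow> (\<exists>M. I = Idl\<^bsub>type_ring\<^esub> (monomial ` M))"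

definition frobenius_power :: "nat \<Rightarrow> ('n, 'k::field) mvpoly set" where
  "frobenius_power q = Idl\<^bsub>type_ring\<^esub> (range (\<lambda>i. var i ^ q))"

text \<open>The maximum is over a finite nonempty set when \<open>I\<close> is a non-zero ideal contained in the
  ideal of the variables and \<open>q > 0\<close>.\<close>

definition nu :: "('n, 'k::field) mvpoly set \<Rightarrow> nat \<Rightarrow> nat" where
  "nu I q = Max {r. \<not> ideal_power I r \<subseteq> frobenius_power q}"

definition F_threshold :: "nat \<Rightarrow> ('n, 'k::field) mvpoly set \<Rightarrow> real" where
  "F_threshold p I = lim (\<lambda>e. real (nu I (p ^ e)) / real (p ^ e))"


subsection \<open>Rees valuations\<close>

definition integral_closure :: "'a::comm_ring_1 set \<Rightarrow> 'a set" where
  "integral_closure I =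
     {f. \<exists>d\<ge>1. \<exists>c. (\<forall>i\<in>{1..d}. c i \<in> ideal_power I i) \<and>
           f ^ d + (\<Sum>i=1..d. c i * f ^ (d - i)) = 0}"

abbreviation sub_ring :: "'a::comm_ring_1 set \<Rightarrow> 'a ring" where
  "sub_ring V \<equiv> type_ring\<lparr>carrier := V\<rparr>"

definition valuation_ring :: "'f::field set \<Rightarrow> bool" where
  "valuation_ring V \<longleftrightarrow> subring V type_ring \<and> (\<forall>x. x \<noteq> 0 \<longrightarrow> x \<in> V \<or> inverse x \<in> V)"

text \<open>The extension of an ideal of the base ring to a ring between it and its fraction field.\<close>

definition extended_ideal :: "'a::idom set \<Rightarrow> 'a fract set \<Rightarrow> 'a fract set" where
  "extended_ideal I V = Idl\<^bsub>sub_ring V\<^esub> (to_fract ` I)"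

definition determines_closures :: "'a::idom set \<Rightarrow> 'a fract set set \<Rightarrow> bool" where
  "determines_closures I Vs \<longleftrightarrow>
     finite Vs \<and>
     (\<forall>V\<in>Vs. valuation_ring V \<and> noetherian_ring (sub_ring V) \<and> \<not> Ring.field (sub_ring V) \<and>
             range to_fract \<subseteq> V) \<and>
     (\<forall>m. integral_closure (ideal_power I m) =
          {f. \<forall>V\<in>Vs. to_fract f \<in> extended_ideal (ideal_power I m) V})"

definition rees_valuation_rings :: "'a::idom set \<Rightarrow> 'a fract set set \<Rightarrow> bool" where
  "rees_valuation_rings I Vs \<longleftrightarrow>
     determines_closures I Vs \<and> (\<forall>Vs'. Vs' \<subset> Vs \<longrightarrow> \<not> determines_closures I Vs')"

text \<open>The valuation of a Noetherian valuation ring that is not a field, normalised to have value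
  group the integers: the exponent of \<open>x\<close> with respect to a generator \<open>t\<close> of the maximal ideal.
  The value at \<open>0\<close> is unspecified.\<close>

definition valuation_of :: "'f::field set \<Rightarrow> 'f \<Rightarrow> int" where
  "valuation_of V x =
     (THE k. \<exists>t u. t \<in> V \<and> maximalideal (PIdl\<^bsub>sub_ring V\<^esub> t) (sub_ring V) \<and>
                   u \<in> Units (sub_ring V) \<and> x = u * t powi k)"

text \<open>\<open>RV\<close> is a set of Rees valuations of \<open>I\<close>, each normalised as above.\<close>

definition rees_valuations :: "'a::idom set \<Rightarrow> ('a fract \<Rightarrow> int) set \<Rightarrow> bool" where
  "rees_valuations I RV \<longleftrightarrow> (\<exists>Vs. rees_valuation_rings I Vs \<and> RV = valuation_of ` Vs)"

definition ideal_value :: "('a::idom fract \<Rightarrow> int) \<Rightarrow> 'a set \<Rightarrow> int" where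
  "ideal_value v J = (LEAST k. \<exists>f\<in>J - {0}. k = v (to_fract f))"

end

theory Submission
  imports Defs
begin

text \<open>
  Write \<open>x\<close> for the product of the variables. Membership in the powers of \<open>\<aa>\<close> is combinatorial:
  \<open>x ^ k \<in> \<aa> ^ r\<close> holds iff some sum of \<open>r\<close> generating exponents has all entries at most \<open>k\<close>, and
  \<open>\<nu> q\<close> is the largest \<open>r\<close> with \<open>x ^ (q - 1) \<in> \<aa> ^ r\<close>. These pairs \<open>(r, k)\<close> form a semigroup, so
  the F-threshold is the supremum of the ratios \<open>r / k\<close>; it is attained, hence rational, because by
  Dickson's lemma the underlying multiplicity vectors are sums of finitely many minimal ones.

  Reading off the coefficient at \<open>x ^ (k * d)\<close> in an equation of integral dependence of degree \<open>d\<close>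
  shows that replacing \<open>\<aa> ^ r\<close> by its integral closure does not change this supremum. Membership
  in the integral closure is the condition \<open>r * v \<aa> \<le> k * v x\<close> for all Rees valuations \<open>v\<close>, and
  \<open>v \<aa> > 0\<close> since otherwise \<open>v\<close> would impose no condition and could be dropped.
\<close>

subsection \<open>Ideals and valuations\<close>

lemma type_ring_simps [simp]:
  "carrier type_ring = UNIV" "monoid.mult type_ring x y = x * y" "ring.add type_ring x y = x + y"
  "monoid.one type_ring = 1" "ring.zero type_ring = 0"
  by (simp_all add: ring_of_type_algebra_def)

lemma a_inv_type_ring [simp]: "a_inv (type_ring :: 'a::comm_ring_1 ring) x = - x"
  using abelian_group.minus_equality[OF ring.is_abelian_group[OF ring_from_type_algebra], of "- x" x]
  by simp

lemma subring_type_ringD: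
  assumes "subring V (type_ring :: 'a::comm_ring_1 ring)"
  shows "0 \<in> V" "1 \<in> V" "x \<in> V \<Longrightarrow> - x \<in> V"
    "x \<in> V \<Longrightarrow> y \<in> V \<Longrightarrow> x + y \<in> V" "x \<in> V \<Longrightarrow> y \<in> V \<Longrightarrow> x * y \<in> V"
  using subringE[OF assms] by auto

text \<open>Additive inverses come from multiplication by -1, which lies in \<open>V\<close>, and
  commutativity makes left multiplication enough. This reduces every later ideal check to three
  closure conditions.\<close>

lemma ideal_sub_ring_iff:
  assumes V: "subring V (type_ring :: 'a::comm_ring_1 ring)"
  shows "ideal J (sub_ring V) \<longleftrightarrow>
    J \<subseteq> V \<and> 0 \<in> J \<and> (\<forall>a\<in>J. \<forall>b\<in>J. a + b \<in> J) \<and> (\<forall>x\<in>V. \<forall>a\<in>J. x * a \<in> J)"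
    (is "_ \<longleftrightarrow> ?R")
proof
  assume "ideal J (sub_ring V)"
  then interpret ideal J "sub_ring V" .
  show ?R
    using a_subset additive_subgroup.zero_closed[OF is_additive_subgroup]
      additive_subgroup.a_closed[OF is_additive_subgroup] I_l_closed by auto
next
  assume R: ?R
  interpret V: ring "sub_ring V"
    by (rule ring.subring_is_ring[OF ring_from_type_algebra V])
  have "- 1 \<in> V"
    using subring_type_ringD[OF V] by blast
  then have minus: "- a \<in> J" if "a \<in> J" for a
    using R that by (metis mult_minus1)
  show "ideal J (sub_ring V)"
  proof (rule idealI)
    show "subgroup J (add_monoid (sub_ring V))"
    proof (rule V.add.subgroupI)
      fix a assume a: "a \<in> J"
      have "a_inv (sub_ring V) a = - a"
        using V.minus_equality[of "- a" a] a minus[OF a] R by auto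
      then show "a_inv (sub_ring V) a \<in> J"
        using minus[OF a] by simp
    qed (use R in auto)
    fix a x assume "a \<in> J" "x \<in> carrier (sub_ring V)"
    then have "x * a \<in> J" using R by auto
    then show "x \<otimes>\<^bsub>sub_ring V\<^esub> a \<in> J" "a \<otimes>\<^bsub>sub_ring V\<^esub> x \<in> J"
      by (simp_all add: mult.commute)
  qed (rule V.ring_axioms)
qed

lemma ideal_type_ring_iff:
  "ideal J (type_ring :: 'a::comm_ring_1 ring) \<longleftrightarrow>
    0 \<in> J \<and> (\<forall>a\<in>J. \<forall>b\<in>J. a + b \<in> J) \<and> (\<forall>x. \<forall>a\<in>J. x * a \<in> J)"
proof -
  have eq: "sub_ring UNIV = (type_ring :: 'a ring)"
    by (simp add: ring_of_type_algebra_def)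
  have "subring UNIV (type_ring :: 'a ring)"
    using ring.carrier_is_subring[OF ring_from_type_algebra] by simp
  from ideal_sub_ring_iff[OF this, of J] show ?thesis
    unfolding eq by simp
qed

lemma one_ideals_set [simp]: "monoid.one (ideals_set R) = carrier R"
  by (simp add: ideals_set_def)

lemma ideal_power_0: "ideal_power I 0 = UNIV"
  by (simp add: ideals_set_def)

lemma ideal_power_Suc: "ideal_power I (Suc r) = ideal_prod type_ring (ideal_power I r) I"
  by (simp add: ideals_set_def)

lemma ideal_ideal_power:
  assumes "ideal I (type_ring :: 'a::comm_ring_1 ring)"
  shows "ideal (ideal_power I r) (type_ring :: 'a ring)"
proof (induction r)
  case 0
  show ?case by (auto simp: ideal_type_ring_iff)
next
  case (Suc r)
  then show ?case
    using ring.ideal_prod_is_ideal[OF ring_from_type_algebra Suc assms] by (simp only: ideal_power_Suc)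
qed

lemma power_mem_ideal_power: "f \<in> I \<Longrightarrow> f ^ r \<in> ideal_power I r"
proof (induction r)
  case (Suc r)
  then have "monoid.mult type_ring (f ^ r) f \<in> ideal_prod type_ring (ideal_power I r) I"
    by (intro ideal_prod.prod) auto
  then show ?case by (simp only: ideal_power_Suc) (simp add: mult.commute)
qed simp

lemma ideal_prod_minimal:
  assumes "ideal K (type_ring :: 'a::comm_ring_1 ring)" "\<And>i j. i \<in> I \<Longrightarrow> j \<in> J \<Longrightarrow> i * j \<in> K"
  shows "ideal_prod type_ring I J \<subseteq> K"
proof
  fix s assume "s \<in> ideal_prod type_ring I J"
  then show "s \<in> K"
    by induction (use assms in \<open>auto simp: ideal_type_ring_iff\<close>)
qed

lemma subset_integral_closure: "J \<subseteq> integral_closure J" if "ideal J (type_ring :: 'a::comm_ring_1 ring)"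
proof
  fix f assume f: "f \<in> J"
  \<comment> \<open>\<open>ideal_power J 1\<close> unfolds to the unit ideal times \<open>J\<close>.
    The first coefficient of an equation of integral dependence over \<open>J\<close> lies in this
    ideal, so \<open>f\<close> satisfies the equation f + (-f) = 0 of degree one.\<close>
  have "ideal_power J 1 = J"
    using ring.ideal_prod_one[OF ring_from_type_algebra that]
      cring.ideal_prod_commute[OF cring_from_type_algebra that ideal_ideal_power[OF that, of 0]]
    by (simp add: ideals_set_def)
  moreover have "- f \<in> J"
    using f that by (metis ideal_type_ring_iff mult_minus1)
  ultimately show "f \<in> integral_closure J"
    unfolding integral_closure_def using f
    by (auto intro!: exI[of _ "1::nat"] exI[of _ "\<lambda>_. - f"])
qed

section \<open>Discrete valuations on a field\<close>

locale discrete_valuation =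
  fixes V :: "'f::field set" and v :: "'f \<Rightarrow> int"
  assumes subring: "subring V type_ring"
    and v_mult: "x \<noteq> 0 \<Longrightarrow> y \<noteq> 0 \<Longrightarrow> v (x * y) = v x + v y"
    and v_nonneg_iff: "x \<noteq> 0 \<Longrightarrow> 0 \<le> v x \<longleftrightarrow> x \<in> V"
begin

lemma v_one [simp]: "v 1 = 0"
  using v_mult[of 1 1] by simp

lemma v_power: "x \<noteq> 0 \<Longrightarrow> v (x ^ n) = int n * v x"
  by (induction n) (auto simp: v_mult algebra_simps)

lemma v_divide:
  assumes "x \<noteq> 0" "y \<noteq> 0"
  shows "v (x / y) = v x - v y"
  using v_mult[of "x / y" y] assms by simp

text \<open>The ultrametric inequality is not an axiom of the locale. It follows from closure of
  \<open>V\<close> under addition: pull out the summand \<open>x\<close> of smaller value, so that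
  the remaining factor 1 + y / x lies in \<open>V\<close>.\<close>

lemma v_add_ge:
  assumes "x \<noteq> 0" "y \<noteq> 0" "x + y \<noteq> 0" "N \<le> v x" "N \<le> v y"
  shows "N \<le> v (x + y)"
proof -
  have *: "N \<le> v (x + y)" if "x \<noteq> 0" "y \<noteq> 0" "x + y \<noteq> 0" "N \<le> v x" "v x \<le> v y" for x y
  proof -
    have "y / x \<in> V"
      using that v_nonneg_iff[of "y / x"] v_divide[of y x] by auto
    then have "1 + y / x \<in> V"
      using subring_type_ringD[OF subring] by blast
    moreover have "1 + y / x \<noteq> 0" "x + y = x * (1 + y / x)"
      using that by (auto simp: field_simps)
    ultimately show ?thesis
      using that v_mult[of x "1 + y / x"] v_nonneg_iff[of "1 + y / x"] by simp
  qed
  show ?thesis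
  proof (cases "v x \<le> v y")
    case True
    then show ?thesis using * assms by blast
  next
    case False
    then show ?thesis using *[of y x] assms by (simp add: add.commute)
  qed
qed

lemma ideal_ge:
  assumes "0 \<le> N"
  shows "ideal {x \<in> V. x = 0 \<or> N \<le> v x} (sub_ring V)"
proof -
  have "N \<le> v (x * a)" if "x \<in> V" "x \<noteq> 0" "a \<noteq> 0" "N \<le> v a" for x a
    using that v_nonneg_iff[of x] by (simp add: v_mult)
  then show ?thesis
    unfolding ideal_sub_ring_iff[OF subring]
    using subring_type_ringD[OF subring] v_add_ge
    by (auto; metis add.right_neutral add.left_neutral)
qed

end

text \<open>This is the uniqueness behind the definite description in \<open>valuation_of\<close>.
  Any two generators of the maximal ideal differ by a unit, so two representations of one element
  force a power of \<open>t\<close> to be a unit, and only the zeroth power is one.\<close>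

lemma valuation_of_eqI:
  assumes V: "valuation_ring V" and t: "t \<in> V" "t \<noteq> 0" "inverse t \<notin> V"
    and nonunit: "\<And>x. x \<in> V \<Longrightarrow> x \<noteq> 0 \<Longrightarrow> inverse x \<notin> V \<Longrightarrow> x / t \<in> V"
    and u: "u \<in> V" "inverse u \<in> V" "u \<noteq> 0"
  shows "valuation_of V (u * t powi k) = k"
proof -
  have S: "subring V type_ring"
    using V by (simp add: valuation_ring_def)
  note D = subring_type_ringD[OF S]
  interpret V: ring "sub_ring V"
    by (rule ring.subring_is_ring[OF ring_from_type_algebra S])
  have Units: "x \<in> Units (sub_ring V) \<longleftrightarrow> x \<in> V \<and> x \<noteq> 0 \<and> inverse x \<in> V" for x
  proof
    assume "x \<in> Units (sub_ring V)"
    then obtain y where "x \<in> V" "y \<in> V" "y * x = 1"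
      by (auto simp: Units_def)
    then show "x \<in> V \<and> x \<noteq> 0 \<and> inverse x \<in> V"
      using inverse_unique[of x y] by (auto simp: mult.commute)
  next
    assume "x \<in> V \<and> x \<noteq> 0 \<and> inverse x \<in> V"
    then show "x \<in> Units (sub_ring V)"
      by (auto simp: Units_def intro!: bexI[of _ "inverse x"])
  qed
  have PIdl: "PIdl\<^bsub>sub_ring V\<^esub> s = {x * s |x. x \<in> V}" for s
    by (simp add: cgenideal_def)
  have ideal_PIdl: "ideal (PIdl\<^bsub>sub_ring V\<^esub> s) (sub_ring V)" if "s \<in> V" for s
    unfolding ideal_sub_ring_iff[OF S] PIdl
  proof (intro conjI ballI)
    show "0 \<in> {x * s |x. x \<in> V}"
      using D by (auto intro!: exI[of _ 0])
    show "a + b \<in> {x * s |x. x \<in> V}" if "a \<in> {x * s |x. x \<in> V}" "b \<in> {x * s |x. x \<in> V}" for a b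
      using that D by (auto simp flip: distrib_right)
    show "y * a \<in> {x * s |x. x \<in> V}" if "y \<in> V" "a \<in> {x * s |x. x \<in> V}" for a y
      using that D by (auto simp flip: mult.assoc)
  qed (use that D in auto)
  have t_notin: "1 \<notin> PIdl\<^bsub>sub_ring V\<^esub> t"
    using t by (auto simp: PIdl) (metis inverse_unique mult.commute)
  have nonunit_mem: "x \<in> PIdl\<^bsub>sub_ring V\<^esub> t" if "x \<in> V" "x = 0 \<or> inverse x \<notin> V" for x
  proof (cases "x = 0")
    case False
    then show ?thesis
      using nonunit[of x] that t by (auto simp: PIdl intro!: exI[of _ "x / t"])
  qed (use D in \<open>auto simp: PIdl\<close>)
  have ideal_unit: "J = V" if "ideal J (sub_ring V)" "1 \<in> J" for J
    using that by (auto simp: ideal_sub_ring_iff[OF S]) (metis mult.right_neutral)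
  have max_t: "maximalideal (PIdl\<^bsub>sub_ring V\<^esub> t) (sub_ring V)"
  proof (intro maximalideal.intro ideal_PIdl t maximalideal_axioms.intro)
    show "carrier (sub_ring V) \<noteq> PIdl\<^bsub>sub_ring V\<^esub> t"
      using t_notin D by auto
    fix J assume J: "ideal J (sub_ring V)" "PIdl\<^bsub>sub_ring V\<^esub> t \<subseteq> J" "J \<subseteq> carrier (sub_ring V)"
    show "J = PIdl\<^bsub>sub_ring V\<^esub> t \<or> J = carrier (sub_ring V)"
    proof (cases "J \<subseteq> PIdl\<^bsub>sub_ring V\<^esub> t")
      case False
      then obtain x where x: "x \<in> J" "x \<notin> PIdl\<^bsub>sub_ring V\<^esub> t" by blast
      then have "x \<in> V" "x \<noteq> 0" "inverse x \<in> V"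
        using nonunit_mem[of x] J by auto
      then have "inverse x * x \<in> J"
        using J(1) x(1) unfolding ideal_sub_ring_iff[OF S] by blast
      then show ?thesis using ideal_unit[OF J(1)] \<open>x \<noteq> 0\<close> by simp
    qed (use J in blast)
  qed
  \<comment> \<open>A generator \<open>s\<close> of a maximal ideal is not a unit, so its ideal lies
    in that of \<open>t\<close>. Maximality gives equality, hence each generator divides the
    other.\<close>
  have assoc: "s \<noteq> 0 \<and> s / t \<in> V \<and> t / s \<in> V"
    if s: "s \<in> V" and max_s: "maximalideal (PIdl\<^bsub>sub_ring V\<^esub> s) (sub_ring V)" for s
  proof -
    interpret s: maximalideal "PIdl\<^bsub>sub_ring V\<^esub> s" "sub_ring V" by (rule max_s)
    have s_mem: "s \<in> PIdl\<^bsub>sub_ring V\<^esub> s"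
      using D by (auto simp: PIdl intro!: exI[of _ 1])
    have "s = 0 \<or> inverse s \<notin> V"
    proof (rule ccontr)
      assume "\<not> (s = 0 \<or> inverse s \<notin> V)"
      then have "1 \<in> PIdl\<^bsub>sub_ring V\<^esub> s"
        by (auto simp: PIdl intro!: exI[of _ "inverse s"])
      then show False using s.I_notcarr ideal_unit[OF s.is_ideal] by simp
    qed
    then have "s \<in> PIdl\<^bsub>sub_ring V\<^esub> t"
      using nonunit_mem s by blast
    then obtain a where a: "a \<in> V" "s = a * t" by (auto simp: PIdl)
    then have "PIdl\<^bsub>sub_ring V\<^esub> s \<subseteq> PIdl\<^bsub>sub_ring V\<^esub> t"
      using D by (auto simp: PIdl simp flip: mult.assoc)
    then have "PIdl\<^bsub>sub_ring V\<^esub> t = PIdl\<^bsub>sub_ring V\<^esub> s"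
      using s.I_maximal[OF ideal_PIdl[OF t(1)]] t_notin D(2)
        ideal_PIdl[OF t(1)] ideal_sub_ring_iff[OF S] by auto
    moreover have "t \<in> PIdl\<^bsub>sub_ring V\<^esub> t"
      using D by (auto simp: PIdl intro!: exI[of _ 1])
    ultimately obtain b where "b \<in> V" "t = b * s" by (auto simp: PIdl)
    moreover from this have "s \<noteq> 0" using t(2) by auto
    moreover have "s / t = a" using a(2) t(2) by simp
    ultimately show ?thesis using a(1) by simp
  qed
  have powi_unit: "w powi k \<in> V" if "w \<in> V" "inverse w \<in> V" for w k
  proof -
    have "w ^ n \<in> V" "inverse w ^ n \<in> V" for n
      using that D by (induction n) auto
    then show ?thesis by (auto simp: power_int_def)
  qed
  show ?thesis
    unfolding valuation_of_def
  proof (rule the_equality)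
    show "\<exists>t' u'. t' \<in> V \<and> maximalideal (PIdl\<^bsub>sub_ring V\<^esub> t') (sub_ring V) \<and>
        u' \<in> Units (sub_ring V) \<and> u * t powi k = u' * t' powi k"
      using max_t t u Units by blast
    fix l assume "\<exists>s w. s \<in> V \<and> maximalideal (PIdl\<^bsub>sub_ring V\<^esub> s) (sub_ring V) \<and>
        w \<in> Units (sub_ring V) \<and> u * t powi k = w * s powi l"
    then obtain s w where s: "s \<in> V" "maximalideal (PIdl\<^bsub>sub_ring V\<^esub> s) (sub_ring V)"
      and w: "w \<in> V" "w \<noteq> 0" "inverse w \<in> V" and eq: "u * t powi k = w * s powi l"
      using Units by blast
    note st = assoc[OF s]
    have "s powi l = (s / t) powi l * t powi l"
      using t by (simp add: power_int_divide_distrib)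
    then have "u * t powi k = w * (s / t) powi l * t powi l"
      using eq by simp
    then have tkl: "t powi (k - l) = inverse u * w * (s / t) powi l"
      using t u by (simp add: power_int_diff field_simps)
    have "t powi (k - l) \<in> V"
      unfolding tkl using st powi_unit[of "s / t" l] u w D by (auto)
    moreover have "inverse (t powi (k - l)) \<in> V"
    proof -
      have "inverse (t powi (k - l)) = u * inverse w * (t / s) powi l"
        unfolding tkl using st u w by (simp add: field_simps power_int_divide_distrib)
      then show ?thesis
        using st powi_unit[of "t / s" l] u w D by (auto)
    qed
    \<comment> \<open>Otherwise multiplication by \<open>t powi (n - 1)\<close> would put
      \<open>inverse t\<close> into \<open>V\<close>. Applied to k - l and to l - k, this excludes
      both signs.\<close>
    moreover have "inverse (t powi n) \<notin> V" if "n > 0" for n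
    proof
      assume "inverse (t powi n) \<in> V"
      moreover have "t powi (n - 1) \<in> V"
      proof -
        have "t ^ m \<in> V" for m
          using t D by (induction m) auto
        then show ?thesis using that by (simp add: power_int_def)
      qed
      ultimately have "inverse (t powi n) * t powi (n - 1) \<in> V"
        using D by blast
      also have "inverse (t powi n) * t powi (n - 1) = inverse t"
        using t by (simp add: power_int_diff field_simps)
      finally show False using t by simp
    qed
    ultimately show "l = k"
      using power_int_minus[of t "k - l"] by (metis diff_gt_0_iff_gt inverse_inverse_eq linorder_neqE minus_diff_eq)
  qed
qed

text \<open>Principal ideals of a valuation ring form a chain, so by Noetherianity every nonempty family of
  nonzero ones has a largest member. For the nonunits this gives a uniformizer \<open>t\<close>; for the ideals
  generated by the \<open>x / t ^ n\<close> it shows that dividing \<open>x\<close> by \<open>t\<close> ends at a unit.\<close>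

lemma discrete_valuation_valuation_of:
  assumes V: "valuation_ring V" and noeth: "noetherian_ring (sub_ring V)"
    and not_field: "\<not> Ring.field (sub_ring V)"
  shows "discrete_valuation V (valuation_of V)"
proof -
  have S: "subring V type_ring" and VK: "\<And>x. x \<noteq> 0 \<Longrightarrow> x \<in> V \<or> inverse x \<in> V"
    using V by (auto simp: valuation_ring_def)
  note D = subring_type_ringD[OF S]
  interpret noetherian_ring "sub_ring V" by (rule noeth)
  interpret V: cring "sub_ring V"
    by unfold_locales (auto simp: mult.commute)
  \<comment> \<open>The intersection with \<open>V\<close> makes \<open>P s\<close> an ideal of
    \<open>V\<close> for every field element \<open>s\<close>, including those outside
    \<open>V\<close>.\<close>
  define P where "P s = {x \<in> V. \<exists>y\<in>V. x = y * s}" for s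
  have ideal_P: "ideal (P s) (sub_ring V)" for s
    unfolding ideal_sub_ring_iff[OF S] P_def
  proof (intro conjI ballI)
    show "a + b \<in> {x \<in> V. \<exists>y\<in>V. x = y * s}" if "a \<in> {x \<in> V. \<exists>y\<in>V. x = y * s}" "b \<in> {x \<in> V. \<exists>y\<in>V. x = y * s}" for a b
      using that D by (auto simp flip: distrib_right)
    show "y * a \<in> {x \<in> V. \<exists>y\<in>V. x = y * s}" if "y \<in> V" "a \<in> {x \<in> V. \<exists>y\<in>V. x = y * s}" for a y
      using that D by (auto simp flip: mult.assoc)
  qed (use D in \<open>auto intro!: bexI[of _ 0]\<close>)
  have P_mono: "P x \<subseteq> P y" if "x / y \<in> V" "y \<noteq> 0" for x y
  proof
    fix a assume "a \<in> P x"
    then obtain b where "a \<in> V" "b \<in> V" "a = b * x" by (auto simp: P_def)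
    moreover have "b * (x / y) \<in> V"
      using that D \<open>b \<in> V\<close> by blast
    ultimately show "a \<in> P y"
      using that by (auto simp: P_def intro!: bexI[of _ "b * (x / y)"])
  qed
  \<comment> \<open>Comparability of \<open>P x\<close> and \<open>P y\<close> is decided by whether
    x / y or y / x lies in \<open>V\<close>; this is why 0 is kept out of \<open>A\<close>.\<close>
  have P_chain: "\<Union> (P ` A) \<in> P ` A" if "A \<noteq> {}" "0 \<notin> A" for A
  proof (rule ideal_chain_is_trivial)
    have comparable: "P x \<subseteq> P y \<or> P y \<subseteq> P x" if "x \<noteq> 0" "y \<noteq> 0" for x y
      using VK[of "x / y"] P_mono[of x y] P_mono[of y x] that by auto
    show "subset.chain {I. ideal I (sub_ring V)} (P ` A)"
      unfolding subset_chain_def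
    proof (intro conjI ballI)
      fix I J assume "I \<in> P ` A" "J \<in> P ` A"
      then obtain x y where "I = P x" "x \<in> A" "J = P y" "y \<in> A" by blast
      moreover from this have "x \<noteq> 0" "y \<noteq> 0" using that(2) by metis+
      ultimately show "I \<subseteq> J \<or> J \<subseteq> I" using comparable by simp
    qed (use ideal_P in blast)
  qed (use that in auto)
  define M where "M = {x \<in> V. x \<noteq> 0 \<and> inverse x \<notin> V}"
  have "M \<noteq> {}"
  proof
    assume M: "M = {}"
    have "Units (sub_ring V) = carrier (sub_ring V) - {\<zero>\<^bsub>sub_ring V\<^esub>}"
    proof (intro equalityI subsetI)
      fix x assume "x \<in> carrier (sub_ring V) - {\<zero>\<^bsub>sub_ring V\<^esub>}"
      then show "x \<in> Units (sub_ring V)"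
        using M by (auto simp: M_def Units_def intro!: bexI[of _ "inverse x"])
    qed (auto simp: Units_def)
    then show False using not_field V.cring_fieldI by blast
  qed
  then obtain t where t: "t \<in> M" "\<Union> (P ` M) = P t"
    using P_chain[of M] by (auto simp: M_def)
  have nonunit: "x / t \<in> V" if "x \<in> V" "x \<noteq> 0" "inverse x \<notin> V" for x
  proof -
    have "x \<in> P x"
      using that D by (auto simp: P_def intro!: bexI[of _ 1])
    then have "x \<in> P t"
      using that t(2) by (auto simp: M_def)
    then show ?thesis using t(1) by (auto simp: P_def M_def)
  qed
  have t': "t \<in> V" "t \<noteq> 0" "inverse t \<notin> V"
    using t by (auto simp: M_def)
  have unit_part: "\<exists>n::nat. x / t ^ n \<in> V \<and> inverse (x / t ^ n) \<in> V" if x: "x \<in> V" "x \<noteq> 0" for x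
  proof (rule ccontr)
    assume none: "\<nexists>n. x / t ^ n \<in> V \<and> inverse (x / t ^ n) \<in> V"
    have inV: "x / t ^ n \<in> V" for n
    proof (induction n)
      case (Suc n)
      then have "x / t ^ n / t \<in> V"
        using nonunit[of "x / t ^ n"] none x t' by auto
      then show ?case by (simp add: mult.commute)
    qed (use x in auto)
    have "0 \<notin> range (\<lambda>n. x / t ^ n)"
      using x t' by auto
    \<comment> \<open>If no quotient is ever a unit, all of them stay in \<open>V\<close>. Once
      their ideals stop growing, at \<open>n\<close>, the next quotient is a multiple of this one,
      and the multiplier has to be \<open>inverse t\<close>, which is not in
      \<open>V\<close>.\<close>
    then obtain n where n: "\<Union> (P ` range (\<lambda>n. x / t ^ n)) = P (x / t ^ n)"
      using P_chain[of "range (\<lambda>n. x / t ^ n)"] by blast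
    have "x / t ^ Suc n \<in> P (x / t ^ Suc n)"
      using inV[of "Suc n"] D by (auto simp: P_def intro!: bexI[of _ 1])
    then have "x / t ^ Suc n \<in> P (x / t ^ n)"
      using n by blast
    then obtain y where y: "y \<in> V" "x / t ^ Suc n = y * (x / t ^ n)"
      unfolding P_def by blast
    have "x / t ^ Suc n = inverse t * (x / t ^ n)"
      by (simp add: divide_inverse)
    then have "y = inverse t"
      using x t' y(2) by simp
    then show False using t' y(1) by simp
  qed
  \<comment> \<open>For \<open>x\<close> outside \<open>V\<close> the inverse is decomposed and the
    exponent changes sign. The last conjunct yields one direction of
    \<open>v_nonneg_iff\<close>.\<close>
  have decomp: "\<exists>u k. x = u * t powi k \<and> u \<in> V \<and> inverse u \<in> V \<and> u \<noteq> 0 \<and> (x \<in> V \<longrightarrow> 0 \<le> k)"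
    if "x \<noteq> 0" for x
  proof (cases "x \<in> V")
    case True
    then obtain n where "x / t ^ n \<in> V \<and> inverse (x / t ^ n) \<in> V"
      using unit_part \<open>x \<noteq> 0\<close> by blast
    then show ?thesis
      using that t' by (intro exI[of _ "x / t ^ n"] exI[of _ "int n"]) auto
  next
    case False
    then obtain n where "inverse x / t ^ n \<in> V \<and> inverse (inverse x / t ^ n) \<in> V"
      using unit_part[of "inverse x"] VK[of x] \<open>x \<noteq> 0\<close> by auto
    then have "x * t ^ n \<in> V" "inverse (x * t ^ n) \<in> V"
      by (simp_all add: divide_inverse)
    moreover have "x = x * t ^ n * t powi - int n"
      using t' by (simp add: power_int_minus)
    ultimately show ?thesis
      using that t' False by (intro exI[of _ "x * t ^ n"] exI[of _ "- int n"]) simp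
  qed
  have val: "valuation_of V (u * t powi k) = k" if "u \<in> V" "inverse u \<in> V" "u \<noteq> 0" for u k
    using valuation_of_eqI[OF V t' _ that] nonunit by blast
  show ?thesis
  proof (rule discrete_valuation.intro[OF S])
    fix x y :: 'a assume xy: "x \<noteq> 0" "y \<noteq> 0"
    obtain u k where u: "x = u * t powi k" "u \<in> V" "inverse u \<in> V" "u \<noteq> 0"
      using decomp[OF xy(1)] by blast
    obtain w l where w: "y = w * t powi l" "w \<in> V" "inverse w \<in> V" "w \<noteq> 0"
      using decomp[OF xy(2)] by blast
    have xy_eq: "x * y = (u * w) * t powi (k + l)"
      using u w t' by (simp add: power_int_add)
    have "u * w \<in> V" "inverse (u * w) \<in> V" "u * w \<noteq> 0"
      using u w D by auto
    then have "valuation_of V (x * y) = k + l"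
      unfolding xy_eq by (intro val)
    moreover have "valuation_of V x = k" "valuation_of V y = l"
      using val u w by simp_all
    ultimately show "valuation_of V (x * y) = valuation_of V x + valuation_of V y"
      by simp
  next
    fix x :: 'a assume x: "x \<noteq> 0"
    obtain u k where u: "x = u * t powi k" "u \<in> V" "inverse u \<in> V" "u \<noteq> 0" "x \<in> V \<longrightarrow> 0 \<le> k"
      using decomp[OF x] by blast
    have "valuation_of V x = k" using val u by simp
    moreover have "x \<in> V" if "0 \<le> k"
    proof -
      have "t ^ n \<in> V" for n using t' D by (induction n) auto
      then show ?thesis using u(1,2) that D by (simp add: power_int_def)
    qed
    ultimately show "0 \<le> valuation_of V x \<longleftrightarrow> x \<in> V"
      using u(5) by blast
  qed
qed

section \<open>Values of ideals and Rees valuations\<close>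

lemma to_fract_power: "to_fract (f ^ n) = to_fract f ^ n"
  by (induction n) auto

lemma
  assumes dv: "discrete_valuation V v" and RV: "range to_fract \<subseteq> V" and I: "0 \<in> I" "I \<noteq> {0}"
  shows ideal_value_attained: "\<exists>f\<in>I. f \<noteq> 0 \<and> v (to_fract f) = ideal_value v I"
    and ideal_value_le: "f \<in> I \<Longrightarrow> f \<noteq> 0 \<Longrightarrow> ideal_value v I \<le> v (to_fract f)"
    and ideal_value_nonneg: "0 \<le> ideal_value v I"
proof -
  interpret discrete_valuation V v by (rule dv)
  \<comment> \<open>The integers are not well-ordered, so the minimum is first taken over the
    naturals. This loses nothing because the base ring lies in \<open>V\<close> and its nonzero
    elements have nonnegative value.\<close>
  define N where "N = (LEAST n. \<exists>f\<in>I - {0}. int n = v (to_fract f))"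
  have nonneg: "0 \<le> v (to_fract f)" if "f \<noteq> 0" for f
    using v_nonneg_iff[of "to_fract f"] RV that by auto
  obtain g where "g \<in> I - {0}" using I by auto
  then have "\<exists>n. \<exists>f\<in>I - {0}. int n = v (to_fract f)"
    using nonneg[of g] by (intro exI[of _ "nat (v (to_fract g))"]) auto
  then have N: "\<exists>f\<in>I - {0}. int N = v (to_fract f)"
    unfolding N_def by (rule LeastI_ex)
  have N_le: "int N \<le> v (to_fract f)" if "f \<in> I - {0}" for f
  proof -
    have "N \<le> nat (v (to_fract f))"
      unfolding N_def by (rule Least_le) (use that nonneg[of f] in \<open>auto intro!: bexI[of _ f]\<close>)
    then show ?thesis using nonneg[of f] that by auto
  qed
  have eq: "ideal_value v I = int N"
    unfolding ideal_value_def by (rule Least_equality) (use N N_le in auto)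
  show "\<exists>f\<in>I. f \<noteq> 0 \<and> v (to_fract f) = ideal_value v I"
    using N eq by auto
  show "f \<in> I \<Longrightarrow> f \<noteq> 0 \<Longrightarrow> ideal_value v I \<le> v (to_fract f)"
    using N_le eq by auto
  show "0 \<le> ideal_value v I"
    using eq by simp
qed

text \<open>Elements of value at least \<open>N\<close>, together with 0, form an ideal of the base
  ring. A product ideal is therefore bounded as soon as its generating products are, and values of
  products add.\<close>

lemma ideal_power_value_ge:
  assumes dv: "discrete_valuation V v" and RV: "range to_fract \<subseteq> V"
    and I: "ideal I type_ring" "I \<noteq> {0}" and f: "f \<in> ideal_power I m" "f \<noteq> 0"
  shows "int m * ideal_value v I \<le> v (to_fract f)"
proof -
  interpret discrete_valuation V v by (rule dv)
  have "0 \<in> I" using I(1) by (simp add: ideal_type_ring_iff)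
  note val = ideal_value_le[OF dv RV \<open>0 \<in> I\<close> I(2)]
  have nonneg: "0 \<le> v (to_fract x)" if "x \<noteq> 0" for x
    using v_nonneg_iff[of "to_fract x"] RV that by auto
  define K where "K N = {f. f = 0 \<or> N \<le> v (to_fract f)}" for N
  have ideal_K: "ideal (K N) type_ring" for N
    unfolding ideal_type_ring_iff
  proof (intro conjI ballI allI)
    fix a b assume "a \<in> K N" "b \<in> K N"
    then show "a + b \<in> K N"
      using v_add_ge[of "to_fract a" "to_fract b" N]
      by (cases "a = 0"; cases "b = 0"; cases "a + b = 0") (auto simp: K_def simp flip: to_fract_add)
  next
    fix x a assume "a \<in> K N"
    then show "x * a \<in> K N"
      using nonneg[of x] v_mult[of "to_fract x" "to_fract a"] by (auto simp: K_def)
  qed (simp add: K_def)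
  have "ideal_power I m \<subseteq> K (int m * ideal_value v I)"
  proof (induction m)
    case 0
    show ?case using nonneg by (auto simp: K_def)
  next
    case (Suc m)
    have "i * j \<in> K (int (Suc m) * ideal_value v I)" if "i \<in> ideal_power I m" "j \<in> I" for i j
    proof -
      have "i = 0 \<or> int m * ideal_value v I \<le> v (to_fract i)"
        using Suc that by (auto simp: K_def)
      moreover have "j = 0 \<or> ideal_value v I \<le> v (to_fract j)"
        using val that by blast
      ultimately show ?thesis
        using v_mult[of "to_fract i" "to_fract j"] by (auto simp: K_def algebra_simps)
    qed
    then show ?case
      unfolding ideal_power_Suc by (intro ideal_prod_minimal ideal_K)
  qed
  then show ?thesis using f by (auto simp: K_def)
qed

text \<open>The extended ideal is contained in the ideal of elements of \<open>V\<close> of large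
  enough value. Conversely, if \<open>g\<close> in \<open>I\<close> has minimal value, then f / g ^
  m has nonnegative value, and f is this element of \<open>V\<close> times g ^ m.\<close>

lemma extended_ideal_power_iff:
  assumes dv: "discrete_valuation V v" and RV: "range to_fract \<subseteq> V"
    and I: "ideal I type_ring" "I \<noteq> {0}" and f: "f \<noteq> 0"
  shows "to_fract f \<in> extended_ideal (ideal_power I m) V \<longleftrightarrow> int m * ideal_value v I \<le> v (to_fract f)"
proof -
  interpret discrete_valuation V v by (rule dv)
  have "0 \<in> I" using I(1) by (simp add: ideal_type_ring_iff)
  note val = ideal_value_nonneg[OF dv RV \<open>0 \<in> I\<close> I(2)] ideal_value_attained[OF dv RV \<open>0 \<in> I\<close> I(2)]
  let ?N = "int m * ideal_value v I"
  show ?thesis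
  proof
    assume "to_fract f \<in> extended_ideal (ideal_power I m) V"
    moreover have "extended_ideal (ideal_power I m) V \<subseteq> {x \<in> V. x = 0 \<or> ?N \<le> v x}"
      unfolding extended_ideal_def genideal_def
      using ideal_ge[of ?N] val(1) RV ideal_power_value_ge[OF dv RV I] by (intro Inter_lower) auto
    ultimately show "?N \<le> v (to_fract f)" using f by auto
  next
    assume le: "?N \<le> v (to_fract f)"
    obtain g where g: "g \<in> I" "g \<noteq> 0" "v (to_fract g) = ideal_value v I"
      using val(2) by blast
    have "to_fract f / to_fract g ^ m \<in> V"
      using le f g v_nonneg_iff[of "to_fract f / to_fract g ^ m"]
        v_divide[of "to_fract f" "to_fract g ^ m"] v_power[of "to_fract g" m] by simp
    moreover have "to_fract f = to_fract f / to_fract g ^ m * to_fract (g ^ m)"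
      using g by (simp add: to_fract_power)
    moreover have "g ^ m \<in> ideal_power I m"
      using g by (simp add: power_mem_ideal_power)
    ultimately show "to_fract f \<in> extended_ideal (ideal_power I m) V"
      unfolding extended_ideal_def genideal_def ideal_sub_ring_iff[OF subring]
      by (smt (verit) InterI image_subset_iff mem_Collect_eq)
  qed
qed

lemma rees_valuation_ringsD:
  assumes rees: "rees_valuation_rings I Vs" and I: "ideal I (type_ring :: 'a::idom ring)" "I \<noteq> {0}" "I \<noteq> UNIV"
  shows "finite Vs" "Vs \<noteq> {}"
    and "V \<in> Vs \<Longrightarrow> discrete_valuation V (valuation_of V)"
    and "V \<in> Vs \<Longrightarrow> range to_fract \<subseteq> V"
    and "V \<in> Vs \<Longrightarrow> 0 < ideal_value (valuation_of V) I"
    and "f \<noteq> 0 \<Longrightarrow> f \<in> integral_closure (ideal_power I m) \<longleftrightarrow>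
      (\<forall>V\<in>Vs. int m * ideal_value (valuation_of V) I \<le> valuation_of V (to_fract f))"
proof -
  have det: "determines_closures I Vs" and min: "\<And>W. W \<subset> Vs \<Longrightarrow> \<not> determines_closures I W"
    using rees by (auto simp: rees_valuation_rings_def)
  have zero: "0 \<in> I" using I(1) by (simp add: ideal_type_ring_iff)
  show fin: "finite Vs" using det by (simp add: determines_closures_def)
  show dv: "discrete_valuation V (valuation_of V)" if "V \<in> Vs" for V
    using det that discrete_valuation_valuation_of by (auto simp: determines_closures_def)
  show RV: "range to_fract \<subseteq> V" if "V \<in> Vs" for V
    using det that by (auto simp: determines_closures_def)
  have ext: "to_fract f \<in> extended_ideal (ideal_power I m) V \<longleftrightarrow>
      int m * ideal_value (valuation_of V) I \<le> valuation_of V (to_fract f)" if "V \<in> Vs" "f \<noteq> 0" for f m V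
    using extended_ideal_power_iff[OF dv RV I(1,2)] that by blast
  have closure: "integral_closure (ideal_power I m) =
      {f. \<forall>V\<in>Vs. to_fract f \<in> extended_ideal (ideal_power I m) V}" for m
    using det by (simp add: determines_closures_def)
  show "f \<in> integral_closure (ideal_power I m) \<longleftrightarrow>
      (\<forall>V\<in>Vs. int m * ideal_value (valuation_of V) I \<le> valuation_of V (to_fract f))" if "f \<noteq> 0" for f m
    unfolding closure using ext that by auto
  \<comment> \<open>With value 0 every extended power of \<open>I\<close> contains the whole base
    ring. Removing \<open>V\<close> then changes none of the intersections, against
    minimality.\<close>
  show "0 < ideal_value (valuation_of V) I" if V: "V \<in> Vs" for V
  proof (rule ccontr)
    assume "\<not> 0 < ideal_value (valuation_of V) I"
    then have 0: "ideal_value (valuation_of V) I = 0"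
      using ideal_value_nonneg[OF dv[OF V] RV[OF V] zero I(2)] by simp
    interpret discrete_valuation V "valuation_of V" by (rule dv[OF V])
    have all: "to_fract f \<in> extended_ideal (ideal_power I m) V" for f m
    proof (cases "f = 0")
      case True
      then show ?thesis
        by (auto simp: extended_ideal_def genideal_def ideal_sub_ring_iff[OF subring])
    next
      case False
      then have "to_fract f \<in> V" "to_fract f \<noteq> 0" using RV[OF V] by auto
      then show ?thesis using ext[OF V False] 0 v_nonneg_iff[of "to_fract f"] by simp
    qed
    have "determines_closures I (Vs - {V})"
      using det all unfolding determines_closures_def by auto
    then show False using min[of "Vs - {V}"] V by blast
  qed
  \<comment> \<open>An empty family would make 1 integral over \<open>I\<close>. All coefficients of
    the equation lie in \<open>I\<close> and sum to -1, so \<open>I\<close> would be the whole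
    ring.\<close>
  show "Vs \<noteq> {}"
  proof
    assume "Vs = {}"
    then have "1 \<in> integral_closure (ideal_power I 1)"
      using closure[of 1] by simp
    then obtain d c where c: "\<forall>i\<in>{1..d}. c i \<in> ideal_power (ideal_power I 1) i"
      and "1 ^ d + (\<Sum>i=1..d. c i * 1 ^ (d - i)) = 0"
      unfolding integral_closure_def by blast
    then have eq: "1 + sum c {1..d} = 0" by simp
    have prod_le: "ideal_prod type_ring A I \<subseteq> I" for A
      by (rule ideal_prod_minimal[OF I(1)]) (use I(1) in \<open>auto simp: ideal_type_ring_iff\<close>)
    have sub: "ideal_power I 1 \<subseteq> I"
      unfolding One_nat_def ideal_power_Suc by (rule prod_le)
    have "ideal_power (ideal_power I 1) i \<subseteq> I" if "i \<ge> 1" for i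
    proof -
      obtain j where j: "i = Suc j" using \<open>i \<ge> 1\<close> by (cases i) auto
      show ?thesis unfolding j ideal_power_Suc
        by (rule ideal_prod_minimal[OF I(1)]) (use I(1) sub in \<open>auto simp: ideal_type_ring_iff\<close>)
    qed
    then have c_mem: "c i \<in> I" if "i \<in> {1..d}" for i
      using c that by fastforce
    have "sum c A \<in> I" if "A \<subseteq> {1..d}" for A
      using that by (induction A rule: infinite_finite_induct)
        (use I(1) zero c_mem in \<open>auto simp: ideal_type_ring_iff\<close>)
    then have "(- 1) * sum c {1..d} \<in> I"
      using I(1) unfolding ideal_type_ring_iff by blast
    moreover have "(- 1) * sum c {1..d} = 1"
      using eq by (simp add: add_eq_0_iff)
    ultimately have "x * 1 \<in> I" for x
      using I(1) unfolding ideal_type_ring_iff by metis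
    then show False using I(3) by auto
  qed
qed


subsection \<open>The semigroup of exponent bounds\<close>

text \<open>Dickson's lemma, for finitely many numerical functions instead of coordinates, so that
  multiplicities and slacks can be mixed later. In the induction step, \<open>G0\<close> handles all
  \<open>a\<close> whose new value exceeds \<open>N\<close>, the bound of \<open>f\<close> on
  \<open>G0\<close>; each of the finitely many levels f a = j with j at most \<open>N\<close> gets
  its own finite set.\<close>

lemma finite_dickson:
  fixes F :: "('a \<Rightarrow> nat) set"
  assumes "finite F"
  shows "\<exists>G\<subseteq>A. finite G \<and> (\<forall>a\<in>A. \<exists>g\<in>G. \<forall>f\<in>F. f g \<le> f a)"
  using assms
proof (induction F arbitrary: A rule: finite_induct)
  case empty
  show ?case
  proof (cases "A = {}")
    case False
    then obtain a where "a \<in> A" by blast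
    then show ?thesis by (intro exI[of _ "{a}"]) auto
  qed auto
next
  case (insert f F)
  obtain G0 where G0: "G0 \<subseteq> A" "finite G0" "\<And>a. a \<in> A \<Longrightarrow> \<exists>g\<in>G0. \<forall>h\<in>F. h g \<le> h a"
    using insert.IH[of A] by blast
  obtain N where N: "\<And>g. g \<in> G0 \<Longrightarrow> f g \<le> N"
    using G0(2) finite_nat_set_iff_bounded_le[of "f ` G0"] by auto
  have "\<forall>j. \<exists>G\<subseteq>{a\<in>A. f a = j}. finite G \<and> (\<forall>a\<in>{a\<in>A. f a = j}. \<exists>g\<in>G. \<forall>h\<in>F. h g \<le> h a)"
    using insert.IH by blast
  from choice[OF this] obtain G where "\<forall>j. G j \<subseteq> {a\<in>A. f a = j} \<and> finite (G j) \<and>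
      (\<forall>a\<in>{a\<in>A. f a = j}. \<exists>g\<in>G j. \<forall>h\<in>F. h g \<le> h a)" ..
  then have G: "\<And>j. G j \<subseteq> {a\<in>A. f a = j}" "\<And>j. finite (G j)"
      "\<And>j a. a \<in> A \<Longrightarrow> f a = j \<Longrightarrow> \<exists>g\<in>G j. \<forall>h\<in>F. h g \<le> h a"
    by simp_all
  have "\<exists>g \<in> G0 \<union> (\<Union>j\<le>N. G j). \<forall>h\<in>insert f F. h g \<le> h a" if a: "a \<in> A" for a
  proof (cases "f a \<le> N")
    case True
    obtain g where "g \<in> G (f a)" "\<forall>h\<in>F. h g \<le> h a"
      using G(3)[OF a refl] by blast
    moreover from this have "f g = f a" using G(1) by blast
    ultimately show ?thesis using True by (intro bexI[of _ g]) auto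
  next
    case False
    obtain g where "g \<in> G0" "\<forall>h\<in>F. h g \<le> h a"
      using G0(3)[OF a] by blast
    then show ?thesis using False N[of g] by (intro bexI[of _ g]) auto
  qed
  moreover have "G0 \<union> (\<Union>j\<le>N. G j) \<subseteq> A"
    using G0(1) G(1) by blast
  moreover have "finite (G0 \<union> (\<Union>j\<le>N. G j))"
    using G0(2) G(2) by simp
  ultimately show ?case by blast
qed

text \<open>Optimality of (r0, k0) bounds every ratio from above. From below, (q - 1) div k0 copies
  of that pair still fit under q - 1, and rounding costs at most r0 / q.\<close>

lemma tendsto_growth_rate:
  fixes P :: "nat \<Rightarrow> nat \<Rightarrow> bool"
  assumes P0: "P 0 0" and add: "\<And>r k s l. P r k \<Longrightarrow> P s l \<Longrightarrow> P (r + s) (k + l)"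
    and mono: "\<And>r k l. P r k \<Longrightarrow> k \<le> l \<Longrightarrow> P r l" and bound: "\<And>r k. P r k \<Longrightarrow> r \<le> C * k"
    and opt: "P r0 k0" "0 < k0" "\<And>r k. P r k \<Longrightarrow> r * k0 \<le> r0 * k"
  shows "(\<lambda>q. real (Max {r. P r (q - 1)}) / real q) \<longlonglongrightarrow> real r0 / real k0"
proof (rule tendsto_sandwich)
  define N where "N q = Max {r. P r (q - 1)}" for q
  have fin: "finite {r. P r k}" for k
    using bound by (auto intro: finite_subset[of _ "{..C * k}"])
  have N: "P (N q) (q - 1)" for q
    using Max_in[OF fin[of "q - 1"]] mono[OF P0, of "q - 1"] by (auto simp: N_def)
  have scale: "P (n * r) (n * k)" if "P r k" for n r k
    by (induction n) (use that P0 add in auto)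
  have upper: "real (N q) / real q \<le> real r0 / real k0" if "q \<ge> 1" for q
  proof -
    have "N q * k0 \<le> r0 * q"
      using opt(3)[OF N[of q]] by (meson diff_le_self dual_order.trans mult_le_mono2)
    then have "real (N q) * real k0 \<le> real r0 * real q"
      by (metis of_nat_le_iff of_nat_mult)
    then show ?thesis using that opt(2) by (simp add: divide_simps)
  qed
  have lower: "real r0 / real k0 - real r0 / real q \<le> real (N q) / real q" if "q \<ge> 1" for q
  proof -
    have "P ((q - 1) div k0 * r0) (q - 1)"
      using mono[OF scale[OF opt(1), of "(q - 1) div k0"], of "q - 1"] by simp
    then have "(q - 1) div k0 * r0 \<le> N q"
      unfolding N_def by (intro Max_ge fin) simp
    \<comment> \<open>The remainder of q - 1 is at most k0 - 1, which just absorbs the shift from q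
      - 1 to q.\<close>
    moreover have "q \<le> (q - 1) div k0 * k0 + k0"
    proof -
      have "(q - 1) mod k0 < k0" using opt(2) by simp
      then show ?thesis
        using div_mult_mod_eq[of "q - 1" k0] that by linarith
    qed
    ultimately have "k0 * ((q - 1) div k0 * r0) \<le> k0 * N q" "r0 * q \<le> r0 * ((q - 1) div k0 * k0 + k0)"
      by (meson mult_le_mono2)+
    moreover have "r0 * ((q - 1) div k0 * k0 + k0) = k0 * ((q - 1) div k0 * r0) + r0 * k0"
      by (simp only: distrib_left mult_ac)
    ultimately have "r0 * q \<le> k0 * N q + r0 * k0"
      by linarith
    then have "real r0 * real q \<le> real k0 * real (N q) + real r0 * real k0"
      by (metis of_nat_add of_nat_le_iff of_nat_mult)
    then have "real r0 / real k0 \<le> (real (N q) + real r0) / real q"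
      using that opt(2) by (simp add: divide_simps mult.commute distrib_left)
    then show ?thesis by (simp add: add_divide_distrib)
  qed
  show "\<forall>\<^sub>F q in sequentially. real r0 / real k0 - real r0 / real q \<le> real (Max {r. P r (q - 1)}) / real q"
    using lower unfolding N_def eventually_sequentially by blast
  show "\<forall>\<^sub>F q in sequentially. real (Max {r. P r (q - 1)}) / real q \<le> real r0 / real k0"
    using upper unfolding N_def eventually_sequentially by blast
  have "(\<lambda>q. real r0 / real k0 - real r0 / real q) \<longlonglongrightarrow> real r0 / real k0 - 0"
    by (intro tendsto_diff tendsto_const lim_const_over_n)
  then show "(\<lambda>q. real r0 / real k0 - real r0 / real q) \<longlonglongrightarrow> real r0 / real k0"
    by simp
qed simp

section \<open>Sums of exponents with bounded entries\<close>

primrec nfold_sums :: "'a::comm_monoid_add set \<Rightarrow> nat \<Rightarrow> 'a set" where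
  "nfold_sums U 0 = {0}"
| "nfold_sums U (Suc r) = {a + u |a u. a \<in> nfold_sums U r \<and> u \<in> U}"

lemma nfold_sums_add: "a \<in> nfold_sums U r \<Longrightarrow> b \<in> nfold_sums U s \<Longrightarrow> a + b \<in> nfold_sums U (r + s)"
proof (induction s arbitrary: b)
  case (Suc s)
  then obtain b' u where "b' \<in> nfold_sums U s" "u \<in> U" "b = b' + u" by auto
  then show ?case using Suc by (auto simp: add.assoc[symmetric])
qed simp

text \<open>By \<open>monomial_const_exponent_mem\<close> this expresses that the k-th power of the
  product of the variables lies in the r-th power of \<open>mon_ideal U\<close>.\<close>

definition fits :: "('n \<Rightarrow>\<^sub>0 nat) set \<Rightarrow> nat \<Rightarrow> nat \<Rightarrow> bool" where
  "fits U r k \<longleftrightarrow> (\<exists>u\<in>nfold_sums U r. \<forall>i. Poly_Mapping.lookup u i \<le> k)"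

lemma fits_0: "fits U 0 0"
  by (simp add: fits_def)

lemma fits_add: "fits U r k \<Longrightarrow> fits U s l \<Longrightarrow> fits U (r + s) (k + l)"
  unfolding fits_def by (meson nfold_sums_add add_mono lookup_add[THEN eq_refl, THEN order_trans])

lemma fits_mono: "fits U r k \<Longrightarrow> k \<le> l \<Longrightarrow> fits U r l"
  unfolding fits_def by (meson order_trans)

text \<open>Compare total degrees: each of the \<open>r\<close> nonzero summands contributes at
  least 1, while a vector with entries at most \<open>k\<close> has degree at most \<open>k\<close>
  times the number of variables.\<close>

lemma fits_bound:
  fixes U :: "('n::finite \<Rightarrow>\<^sub>0 nat) set"
  assumes "0 \<notin> U" "fits U r k"
  shows "r \<le> card (UNIV :: 'n set) * k"
proof -
  have "r \<le> (\<Sum>i\<in>UNIV. Poly_Mapping.lookup u i)" if "u \<in> nfold_sums U r" for u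
    using that
  proof (induction r arbitrary: u)
    case (Suc r)
    then obtain a m where u: "u = a + m" "a \<in> nfold_sums U r" "m \<in> U" by auto
    have "m \<noteq> 0" using u(3) assms(1) by blast
    then obtain i where "Poly_Mapping.lookup m i \<noteq> 0"
      using poly_mapping_eqI[of m 0] by auto
    then have "1 \<le> (\<Sum>i\<in>UNIV. Poly_Mapping.lookup m i)"
      using member_le_sum[of i UNIV "Poly_Mapping.lookup m"] by simp
    then show ?case
      using Suc.IH[OF u(2)] u(1) by (simp add: lookup_add sum.distrib)
  qed simp
  moreover obtain u where "u \<in> nfold_sums U r" and "\<And>i. Poly_Mapping.lookup u i \<le> k"
    using assms(2) by (auto simp: fits_def)
  moreover from this have "(\<Sum>i\<in>UNIV. Poly_Mapping.lookup u i) \<le> card (UNIV :: 'n set) * k"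
    using sum_bounded_above[of UNIV "Poly_Mapping.lookup u" k] by simp
  ultimately show ?thesis using order_trans by blast
qed

text \<open>Replacing each summand by an element of \<open>M\<close> below it only lowers the
  entries of the sum. Hence it suffices to record how often each element of \<open>M\<close> is
  used, which leaves finitely many counters.\<close>

lemma fits_iff_multiplicities:
  assumes M: "finite M" "M \<subseteq> U" "\<And>u. u \<in> U \<Longrightarrow> \<exists>m\<in>M. \<forall>i. Poly_Mapping.lookup m i \<le> Poly_Mapping.lookup u i"
  shows "fits U r k \<longleftrightarrow> (\<exists>c. sum c M = r \<and> (\<forall>i. (\<Sum>m\<in>M. c m * Poly_Mapping.lookup m i) \<le> k))"
proof
  have "\<exists>c. sum c M = r \<and> (\<forall>i. (\<Sum>m\<in>M. c m * Poly_Mapping.lookup m i) \<le> Poly_Mapping.lookup u i)"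
    if "u \<in> nfold_sums U r" for u
    using that
  proof (induction r arbitrary: u)
    case (Suc r)
    then obtain a v where u: "u = a + v" "a \<in> nfold_sums U r" "v \<in> U" by auto
    obtain c where c: "sum c M = r" "\<And>i. (\<Sum>m\<in>M. c m * Poly_Mapping.lookup m i) \<le> Poly_Mapping.lookup a i"
      using Suc.IH[OF u(2)] by blast
    obtain n where n: "n \<in> M" "\<And>i. Poly_Mapping.lookup n i \<le> Poly_Mapping.lookup v i"
      using M(3)[OF u(3)] by blast
    let ?c = "c(n := Suc (c n))"
    \<comment> \<open>A general weight \<open>g\<close> covers both uses: the constant 1 counts
      summands, and a coordinate gives the entries.\<close>
    have *: "(\<Sum>m\<in>M. ?c m * g m) = (\<Sum>m\<in>M. c m * g m) + g n" for g
      using M(1) n(1) by (simp add: sum.remove[of M n] algebra_simps)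
    from *[of "\<lambda>_. 1"] have "sum ?c M = Suc r" using c(1) by simp
    moreover have "(\<Sum>m\<in>M. ?c m * Poly_Mapping.lookup m i) \<le> Poly_Mapping.lookup u i" for i
      unfolding * u(1) lookup_add using c(2) n(2) by (intro add_mono)
    ultimately show ?case by blast
  qed (auto intro!: exI[of _ "\<lambda>_. 0"])
  then show "fits U r k \<Longrightarrow> \<exists>c. sum c M = r \<and> (\<forall>i. (\<Sum>m\<in>M. c m * Poly_Mapping.lookup m i) \<le> k)"
    unfolding fits_def by (meson order_trans)
next
  have rep: "(\<exists>u\<in>nfold_sums U n. \<forall>i. Poly_Mapping.lookup u i = n * Poly_Mapping.lookup m i)" if "m \<in> U" for m n
  proof (induction n)
    case (Suc n)
    then obtain u where "u \<in> nfold_sums U n" "\<And>i. Poly_Mapping.lookup u i = n * Poly_Mapping.lookup m i" by blast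
    then show ?case using that by (intro bexI[of _ "u + m"]) (auto simp: lookup_add)
  qed simp
  have "\<exists>u\<in>nfold_sums U (sum c M). \<forall>i. Poly_Mapping.lookup u i = (\<Sum>m\<in>M. c m * Poly_Mapping.lookup m i)" for c
    using M(1,2)
  proof (induction M rule: finite_induct)
    case (insert m M)
    obtain u where u: "u \<in> nfold_sums U (sum c M)" "\<And>i. Poly_Mapping.lookup u i = (\<Sum>m\<in>M. c m * Poly_Mapping.lookup m i)"
      using insert by auto
    obtain w where w: "w \<in> nfold_sums U (c m)" "\<And>i. Poly_Mapping.lookup w i = c m * Poly_Mapping.lookup m i"
      using rep insert.prems by blast
    have "w + u \<in> nfold_sums U (sum c (insert m M))"
      using nfold_sums_add[OF w(1) u(1)] insert.hyps by simp
    then show ?case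
      using insert.hyps u(2) w(2) by (intro bexI[of _ "w + u"]) (auto simp: lookup_add)
  qed simp
  then show "\<exists>c. sum c M = r \<and> (\<forall>i. (\<Sum>m\<in>M. c m * Poly_Mapping.lookup m i) \<le> k) \<Longrightarrow> fits U r k"
    unfolding fits_def by metis
qed

text \<open>If a minimal point lies below \<open>(c, k)\<close> in all multiplicities and slacks, the difference is again
  a point, so the ratio of \<open>(c, k)\<close> is at most the largest ratio of a minimal point.\<close>

lemma fits_optimum:
  fixes U :: "('n::finite \<Rightarrow>\<^sub>0 nat) set"
  assumes "0 \<notin> U"
  obtains r0 k0 where "fits U r0 k0" "0 < k0" "\<And>r k. fits U r k \<Longrightarrow> r * k0 \<le> r0 * k"
proof -
  obtain M where M: "M \<subseteq> U" "finite M" "\<And>u. u \<in> U \<Longrightarrow> \<exists>m\<in>M. \<forall>i. Poly_Mapping.lookup m i \<le> Poly_Mapping.lookup u i"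
    using finite_dickson[of "range (\<lambda>i u. Poly_Mapping.lookup u i)" U] by fastforce
  have fits: "fits U r k \<longleftrightarrow> (\<exists>c. sum c M = r \<and> (\<forall>i. (\<Sum>m\<in>M. c m * Poly_Mapping.lookup m i) \<le> k))" for r k
    by (rule fits_iff_multiplicities[OF M(2,1)]) (rule M(3))
  define S where "S c i = (\<Sum>m\<in>M. c m * Poly_Mapping.lookup m i)" for c :: "('n \<Rightarrow>\<^sub>0 nat) \<Rightarrow> nat" and i
  define T where "T = {(c, k). 0 < k \<and> (\<forall>i. S c i \<le> k)}"
  \<comment> \<open>The functions to be compared are \<open>k\<close>, the multiplicities on
    \<open>M\<close> and the slacks in each coordinate. The slacks are what makes the difference of
    two comparable points satisfy the bounds again.\<close>
  let ?F = "insert snd ((\<lambda>m (c, k). c m) ` M \<union> range (\<lambda>i (c, k). k - S c i))"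
  obtain G where G: "G \<subseteq> T" "finite G" "\<And>a. a \<in> T \<Longrightarrow> \<exists>g\<in>G. \<forall>f\<in>?F. f g \<le> f a"
    using finite_dickson[of ?F T] M(2) by auto
  have Tne: "((\<lambda>_. 0), 1) \<in> T" by (simp add: T_def S_def)
  then have "G \<noteq> {}" using G(3) by blast
  define ratio where "ratio = (\<lambda>(c, k). real (sum c M) / real k)"
  have "Max (ratio ` G) \<in> ratio ` G"
    using G(2) \<open>G \<noteq> {}\<close> by simp
  then obtain c0 k0 where g0: "(c0, k0) \<in> G" and "Max (ratio ` G) = ratio (c0, k0)"
    by auto
  then have max: "ratio g \<le> ratio (c0, k0)" if "g \<in> G" for g
    using Max_ge[of "ratio ` G" "ratio g"] G(2) that by simp
  have le0: "sum c M * k0 \<le> sum c0 M * k" if "(c, k) \<in> G" for c k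
  proof -
    have "0 < k" "0 < k0" using that g0 G(1) by (auto simp: T_def)
    moreover have "real (sum c M) / real k \<le> real (sum c0 M) / real k0"
      using max[OF that] by (simp add: ratio_def)
    ultimately have "real (sum c M) * real k0 \<le> real (sum c0 M) * real k"
      by (simp add: divide_simps)
    then show ?thesis by (metis of_nat_le_iff of_nat_mult)
  qed
  have all: "sum c M * k0 \<le> sum c0 M * k" if "(c, k) \<in> T" for c k
    using that
  proof (induction k arbitrary: c rule: less_induct)
    case (less k)
    obtain c' k' where g: "(c', k') \<in> G" and le_F: "\<forall>f\<in>?F. f (c', k') \<le> f (c, k)"
      using G(3)[OF less.prems] by auto
    have le: "k' \<le> k"
      using le_F by simp
    have le_c: "c' m \<le> c m" if "m \<in> M" for m
      using bspec[OF le_F, of "\<lambda>(c, k). c m"] that by simp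
    have le_slack: "k' - S c' i \<le> k - S c i" for i
      using bspec[OF le_F, of "\<lambda>(c, k). k - S c i"] by simp
    have k': "0 < k'" "\<And>i. S c' i \<le> k'" and Sc: "\<And>i. S c i \<le> k"
      using g G(1) less.prems by (auto simp: T_def)
    define d where "d m = c m - c' m" for m
    have split: "(\<Sum>m\<in>M. c m * h m) = (\<Sum>m\<in>M. c' m * h m) + (\<Sum>m\<in>M. d m * h m)" for h
      unfolding sum.distrib[symmetric] using le_c
      by (intro sum.cong refl) (auto simp: d_def simp flip: distrib_right)
    have sum_c: "sum c M = sum c' M + sum d M"
      using split[of "\<lambda>_. 1"] by simp
    \<comment> \<open>This is the slack inequality rearranged; truncated subtraction is harmless as
      both sums stay within their bounds on \<open>T\<close>.\<close>
    have Sd: "S d i \<le> k - k'" for i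
      using split[of "\<lambda>m. Poly_Mapping.lookup m i"] le_slack[of i] k'(2)[of i] Sc[of i] le
      by (simp add: S_def)
    show ?case
    \<comment> \<open>If k' = k, the difference has no room in any coordinate and vanishes on
      \<open>M\<close>, since each exponent there is nonzero. Otherwise it is a point of
      \<open>T\<close> with smaller bound, and the two inequalities add up.\<close>
    proof (cases "k' = k")
      case True
      have "d m = 0" if "m \<in> M" for m
      proof -
        have "m \<noteq> 0" using that assms M(1) by blast
        then obtain i where "Poly_Mapping.lookup m i \<noteq> 0"
          using poly_mapping_eqI[of m 0] by auto
        moreover have "S d i = 0" using Sd[of i] True by simp
        ultimately show ?thesis using M(2) that by (auto simp: S_def)
      qed
      then show ?thesis using sum_c le0[OF g] True by simp
    next
      case False
      then have "(d, k - k') \<in> T" using Sd le by (auto simp: T_def)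
      then have "sum d M * k0 \<le> sum c0 M * (k - k')"
        using less.IH[of "k - k'" d] k'(1) le by auto
      then have "sum c M * k0 \<le> sum c0 M * k' + sum c0 M * (k - k')"
        unfolding sum_c distrib_right using le0[OF g] by (rule add_mono[rotated])
      then show ?thesis using le by (simp flip: distrib_left)
    qed
  qed
  have g0': "0 < k0" "\<And>i. S c0 i \<le> k0" using g0 G(1) by (auto simp: T_def)
  show ?thesis
  proof (rule that)
    show "fits U (sum c0 M) k0" unfolding fits using g0' by (auto simp: S_def)
    show "r * k0 \<le> sum c0 M * k" if fit: "fits U r k" for r k
    \<comment> \<open>Points with bound 0 are not in \<open>T\<close>; for them
      \<open>fits_bound\<close> forces r = 0.\<close>
    proof (cases "k = 0")
      case True
      then show ?thesis using fits_bound[OF assms fit] by simp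
    next
      case False
      then show ?thesis using fit all unfolding fits by (auto simp: T_def S_def)
    qed
  qed (rule g0')
qed


subsection \<open>Monomial ideals\<close>

text \<open>A description by supports of the ideal generated by the monomials with exponents in
  \<open>U\<close> (see \<open>genideal_monomial\<close>); membership becomes a comparison of
  exponents.\<close>

definition mon_ideal :: "('n \<Rightarrow>\<^sub>0 nat) set \<Rightarrow> ('n, 'k::field) mvpoly set" where
  "mon_ideal U = {f. \<forall>w\<in>Poly_Mapping.keys f. \<exists>u\<in>U. \<forall>i. Poly_Mapping.lookup u i \<le> Poly_Mapping.lookup w i}"

lemma keys_monomial [simp]: "Poly_Mapping.keys (monomial w :: ('n, 'k::field) mvpoly) = {w}"
  by (simp add: monomial_def)

lemma monomial_nonzero [simp]: "monomial w \<noteq> (0 :: ('n, 'k::field) mvpoly)"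
  by (metis keys_monomial keys_zero insert_not_empty)

lemma monomial_add: "monomial (u + w) = monomial u * monomial w"
  by (simp add: monomial_def mult_single)

lemma monomial_mem_mon_ideal_iff:
  "monomial w \<in> mon_ideal U \<longleftrightarrow> (\<exists>u\<in>U. \<forall>i. Poly_Mapping.lookup u i \<le> Poly_Mapping.lookup w i)"
  by (simp add: mon_ideal_def)

lemma ideal_mon_ideal: "ideal (mon_ideal U :: ('n, 'k::field) mvpoly set) type_ring"
  unfolding ideal_type_ring_iff
proof (intro conjI ballI allI)
  fix a b :: "('n, 'k) mvpoly"
  assume "a \<in> mon_ideal U" "b \<in> mon_ideal U"
  then show "a + b \<in> mon_ideal U"
    using Poly_Mapping.keys_add[of a b] by (auto simp: mon_ideal_def)
next
  fix x a :: "('n, 'k) mvpoly"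
  assume a: "a \<in> mon_ideal U"
  show "x * a \<in> mon_ideal U"
    unfolding mon_ideal_def
  proof safe
    fix w assume "w \<in> Poly_Mapping.keys (x * a)"
    then obtain y z where w: "w = y + z" "z \<in> Poly_Mapping.keys a"
      using keys_mult[of x a] by blast
    then obtain u where "u \<in> U" "\<And>i. Poly_Mapping.lookup u i \<le> Poly_Mapping.lookup z i"
      using a by (auto simp: mon_ideal_def)
    then show "\<exists>u\<in>U. \<forall>i. Poly_Mapping.lookup u i \<le> Poly_Mapping.lookup w i"
      unfolding w by (intro bexI[of _ u]) (auto simp: lookup_add intro: trans_le_add2)
  qed
qed (simp add: mon_ideal_def)

lemma sum_single_keys: "(\<Sum>w\<in>Poly_Mapping.keys f. Poly_Mapping.single w (Poly_Mapping.lookup f w)) = f"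
  by (rule poly_mapping_eqI) (auto simp: lookup_sum lookup_single when_def not_in_keys_iff_lookup_eq_zero)

lemma mon_ideal_minimal:
  fixes J :: "('n, 'k::field) mvpoly set"
  assumes J: "ideal J type_ring" and U: "monomial ` U \<subseteq> J"
  shows "mon_ideal U \<subseteq> J"
proof
  fix f :: "('n, 'k) mvpoly"
  assume f: "f \<in> mon_ideal U"
  have "Poly_Mapping.single w (Poly_Mapping.lookup f w) \<in> J" if w: "w \<in> Poly_Mapping.keys f" for w
  proof -
    obtain u where u: "u \<in> U" "\<And>i. Poly_Mapping.lookup u i \<le> Poly_Mapping.lookup w i"
      using f w by (auto simp: mon_ideal_def)
    \<comment> \<open>Subtraction of exponents is truncated, so this needs \<open>u\<close> to lie
      below \<open>w\<close>; it exhibits the term of \<open>f\<close> at \<open>w\<close> as a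
      multiple of a generator.\<close>
    have "w - u + u = w"
      by (rule poly_mapping_eqI) (use u(2) in \<open>simp add: lookup_add lookup_minus\<close>)
    then have "Poly_Mapping.single w (Poly_Mapping.lookup f w) =
        Poly_Mapping.single (w - u) (Poly_Mapping.lookup f w) * monomial u"
      by (simp add: monomial_def mult_single)
    moreover have "monomial u \<in> J" using u(1) U by blast
    ultimately show ?thesis using J by (auto simp: ideal_type_ring_iff)
  qed
  then have "(\<Sum>w\<in>A. Poly_Mapping.single w (Poly_Mapping.lookup f w)) \<in> J" if "A \<subseteq> Poly_Mapping.keys f" for A
    using that by (induction A rule: infinite_finite_induct) (use J in \<open>auto simp: ideal_type_ring_iff\<close>)
  then show "f \<in> J" using sum_single_keys[of f] by fastforce
qed

lemma monomial_subset_mon_ideal: "monomial ` U \<subseteq> mon_ideal U"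
  by (auto simp: monomial_mem_mon_ideal_iff)

lemma genideal_monomial: "Idl\<^bsub>type_ring\<^esub> (monomial ` U) = (mon_ideal U :: ('n, 'k::field) mvpoly set)"
  unfolding genideal_def
  using ideal_mon_ideal[of U] monomial_subset_mon_ideal[of U] mon_ideal_minimal[of _ U] by blast

text \<open>Every exponent of a product of polynomials is a sum of exponents of the factors, so the
  supports give one inclusion; products of generators give the other.\<close>

lemma ideal_prod_mon_ideal:
  "ideal_prod type_ring (mon_ideal A) (mon_ideal B) = (mon_ideal {a + b |a b. a \<in> A \<and> b \<in> B} :: ('n, 'k::field) mvpoly set)"
    (is "?L = mon_ideal ?AB")
proof
  show "?L \<subseteq> mon_ideal ?AB"
  proof (rule ideal_prod_minimal[OF ideal_mon_ideal])
    fix f g :: "('n, 'k) mvpoly"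
    assume fg: "f \<in> mon_ideal A" "g \<in> mon_ideal B"
    show "f * g \<in> mon_ideal ?AB"
      unfolding mon_ideal_def
    proof safe
      fix w assume "w \<in> Poly_Mapping.keys (f * g)"
      then obtain y z where w: "w = y + z" "y \<in> Poly_Mapping.keys f" "z \<in> Poly_Mapping.keys g"
        using keys_mult[of f g] by blast
      obtain a where "a \<in> A" "\<And>i. Poly_Mapping.lookup a i \<le> Poly_Mapping.lookup y i"
        using fg(1) w(2) by (auto simp: mon_ideal_def)
      moreover obtain b where "b \<in> B" "\<And>i. Poly_Mapping.lookup b i \<le> Poly_Mapping.lookup z i"
        using fg(2) w(3) by (auto simp: mon_ideal_def)
      ultimately show "\<exists>u\<in>?AB. \<forall>i. Poly_Mapping.lookup u i \<le> Poly_Mapping.lookup w i"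
        unfolding w by (intro bexI[of _ "a + b"]) (auto simp: lookup_add intro: add_mono)
    qed
  qed
  have "monomial (a + b) \<in> ?L" if "a \<in> A" "b \<in> B" for a b
    using ideal_prod.prod[of "monomial a" "mon_ideal A" "monomial b" "mon_ideal B" type_ring]
      monomial_subset_mon_ideal that by (auto simp: monomial_add)
  then show "mon_ideal ?AB \<subseteq> ?L"
    using ring.ideal_prod_is_ideal[OF ring_from_type_algebra ideal_mon_ideal ideal_mon_ideal]
    by (intro mon_ideal_minimal) auto
qed

lemma ideal_power_mon_ideal: "ideal_power (mon_ideal U) r = (mon_ideal (nfold_sums U r) :: ('n, 'k::field) mvpoly set)"
proof (induction r)
  case 0
  show ?case unfolding ideal_power_0 by (auto simp: mon_ideal_def)
next
  case (Suc r)
  then show ?case by (simp only: ideal_power_Suc ideal_prod_mon_ideal nfold_sums.simps)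
qed

text \<open>The coefficients in an integral equation over a power of an ideal lie in powers of that
  power; this turns them into powers of the original ideal.\<close>

lemma ideal_power_mult:
  assumes "ideal I (type_ring :: 'a::comm_ring_1 ring)"
  shows "ideal_power (ideal_power I r) s = ideal_power I (r * s)"
proof -
  interpret comm_monoid "ideals_set (type_ring :: 'a ring)"
    by (rule cring.ideals_set_is_comm_monoid[OF cring_from_type_algebra])
  show ?thesis using nat_pow_pow[of I r s] assms by (simp add: ideals_set_def)
qed

section \<open>Powers of the product of the variables and the F-threshold\<close>

definition const_exponent :: "nat \<Rightarrow> ('n::finite \<Rightarrow>\<^sub>0 nat)" where
  "const_exponent k = (\<Sum>i\<in>UNIV. Poly_Mapping.single i k)"

lemma lookup_const_exponent [simp]: "Poly_Mapping.lookup (const_exponent k) i = k"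
  by (simp add: const_exponent_def lookup_sum lookup_single when_def)

lemma const_exponent_add: "const_exponent (k + l) = const_exponent k + const_exponent l"
  by (rule poly_mapping_eqI) (simp add: lookup_add)

lemma monomial_const_exponent_power: "monomial (const_exponent k) ^ n = monomial (const_exponent (k * n))"
proof (induction n)
  case 0
  have "const_exponent 0 = (0 :: 'a \<Rightarrow>\<^sub>0 nat)"
    by (rule poly_mapping_eqI) simp
  then show ?case by (simp add: monomial_def)
next
  case (Suc n)
  then show ?case by (simp add: const_exponent_add monomial_add)
qed

lemma prod_var_power: "(\<Prod>i\<in>UNIV. var i) ^ k = (monomial (const_exponent k) :: ('n::finite, 'k::field) mvpoly)"
proof -
  have "(\<Prod>i\<in>A. var i) = (monomial (\<Sum>i\<in>A. Poly_Mapping.single i 1) :: ('n, 'k) mvpoly)" for A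
    by (induction A rule: infinite_finite_induct) (simp_all add: var_def monomial_add, simp_all add: monomial_def)
  then have "(\<Prod>i\<in>UNIV. var i) = (monomial (const_exponent 1) :: ('n, 'k) mvpoly)"
    by (simp add: const_exponent_def)
  then show ?thesis by (simp add: monomial_const_exponent_power)
qed

lemma var_power: "var i ^ q = (monomial (Poly_Mapping.single i q) :: ('n, 'k::field) mvpoly)"
proof (induction q)
  case (Suc q)
  have "Poly_Mapping.single i (Suc q) = Poly_Mapping.single i 1 + Poly_Mapping.single i q"
    by (metis single_add plus_1_eq_Suc)
  then show ?case using Suc by (simp add: var_def monomial_add)
qed (simp add: monomial_def)

lemma frobenius_power_eq:
  "frobenius_power q = (mon_ideal (range (\<lambda>i. Poly_Mapping.single i q)) :: ('n, 'k::field) mvpoly set)"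
  unfolding frobenius_power_def var_power genideal_monomial[symmetric] by (simp add: image_image)

lemma monomial_const_exponent_mem:
  "monomial (const_exponent k) \<in> ideal_power (mon_ideal U) r \<longleftrightarrow> fits U r k"
  by (simp add: ideal_power_mon_ideal monomial_mem_mon_ideal_iff fits_def)

text \<open>A monomial lies outside the Frobenius power exactly if all its exponents are at most q -
  1, that is, if it divides the (q - 1)-th power of the product of the variables. So that single
  power tests the inclusion.\<close>

lemma not_subset_frobenius_power_iff:
  fixes U :: "('n::finite \<Rightarrow>\<^sub>0 nat) set"
  assumes "0 < q"
  shows "\<not> ideal_power (mon_ideal U) r \<subseteq> (frobenius_power q :: ('n, 'k::field) mvpoly set) \<longleftrightarrow> fits U r (q - 1)"
proof
  assume "fits U r (q - 1)"
  then have "monomial (const_exponent (q - 1)) \<in> (ideal_power (mon_ideal U) r :: ('n, 'k) mvpoly set)"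
    by (simp add: monomial_const_exponent_mem)
  moreover have "monomial (const_exponent (q - 1)) \<notin> (frobenius_power q :: ('n, 'k) mvpoly set)"
  proof -
    have "\<exists>j. \<not> Poly_Mapping.lookup (Poly_Mapping.single i q) j \<le> q - 1" for i :: 'n
      using assms by (intro exI[of _ i]) simp
    then show ?thesis
      by (simp add: frobenius_power_eq monomial_mem_mon_ideal_iff)
  qed
  ultimately show "\<not> ideal_power (mon_ideal U) r \<subseteq> (frobenius_power q :: ('n, 'k) mvpoly set)"
    by blast
next
  assume "\<not> ideal_power (mon_ideal U) r \<subseteq> (frobenius_power q :: ('n, 'k) mvpoly set)"
  then obtain f :: "('n, 'k) mvpoly" where f: "f \<in> mon_ideal (nfold_sums U r)"
      and "f \<notin> mon_ideal (range (\<lambda>i. Poly_Mapping.single i q))"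
    unfolding frobenius_power_eq ideal_power_mon_ideal by blast
  then obtain w where w: "w \<in> Poly_Mapping.keys f"
      and notin: "\<And>i. \<not> (\<forall>j. Poly_Mapping.lookup (Poly_Mapping.single i q) j \<le> Poly_Mapping.lookup w j)"
    by (auto simp: mon_ideal_def)
  obtain u where "u \<in> nfold_sums U r" and u: "\<And>i. Poly_Mapping.lookup u i \<le> Poly_Mapping.lookup w i"
    using f w by (auto simp: mon_ideal_def)
  moreover have less: "Poly_Mapping.lookup w i < q" for i
    using notin[of i] by (auto simp: lookup_single when_def not_le split: if_splits)
  moreover have "Poly_Mapping.lookup u i \<le> q - 1" for i
    using u[of i] less[of i] by linarith
  ultimately show "fits U r (q - 1)"
    unfolding fits_def by blast
qed

text \<open>In an integral equation of degree \<open>d\<close> for f = x ^ k, with x the product of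
  the variables, the leading term has coefficient 1 at x ^ (k * d). Some summand c i * f ^ (d - i)
  must cancel it, so c i, which lies in the (r * i)-th power, contains the monomial x ^ (k * i). The
  pair is scaled by i but keeps its ratio.\<close>

lemma fits_if_integral:
  fixes U :: "('n::finite \<Rightarrow>\<^sub>0 nat) set"
  assumes "monomial (const_exponent k) \<in> integral_closure (ideal_power (mon_ideal U) r :: ('n, 'k::field) mvpoly set)"
  obtains i where "1 \<le> i" "fits U (r * i) (k * i)"
proof -
  let ?f = "monomial (const_exponent k) :: ('n, 'k) mvpoly"
  obtain d c where "1 \<le> d" and c: "\<And>i. i \<in> {1..d} \<Longrightarrow> c i \<in> ideal_power (ideal_power (mon_ideal U) r) i"
    and eq: "?f ^ d + (\<Sum>i=1..d. c i * ?f ^ (d - i)) = 0"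
    using assms unfolding integral_closure_def by blast
  let ?w = "const_exponent (k * d) :: 'n \<Rightarrow>\<^sub>0 nat"
  have "Poly_Mapping.lookup (?f ^ d + (\<Sum>i=1..d. c i * ?f ^ (d - i))) ?w = 0"
    unfolding eq by simp
  moreover have "Poly_Mapping.lookup (?f ^ d) ?w = 1"
    by (simp add: monomial_const_exponent_power) (simp add: monomial_def)
  ultimately have "(\<Sum>i=1..d. Poly_Mapping.lookup (c i * ?f ^ (d - i)) ?w) \<noteq> 0"
    by (auto simp: lookup_add lookup_sum)
  then obtain i where i: "i \<in> {1..d}" "Poly_Mapping.lookup (c i * ?f ^ (d - i)) ?w \<noteq> 0"
    by (meson sum.not_neutral_contains_not_neutral)
  then have "?w \<in> Poly_Mapping.keys (c i * monomial (const_exponent (k * (d - i))))"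
    by (simp only: monomial_const_exponent_power lookup_not_eq_zero_eq_in_keys)
  then obtain a where a: "a \<in> Poly_Mapping.keys (c i)" "?w = a + const_exponent (k * (d - i))"
    using keys_mult[of "c i" "monomial (const_exponent (k * (d - i)))"] by auto
  have "Poly_Mapping.lookup a j = k * i" for j
  proof -
    have "k * d = Poly_Mapping.lookup a j + k * (d - i)"
      using arg_cong[OF a(2), of "\<lambda>w. Poly_Mapping.lookup w j"] by (simp add: lookup_add)
    moreover have "k * d = k * i + k * (d - i)"
      using i(1) by (simp flip: distrib_left)
    ultimately show ?thesis by linarith
  qed
  moreover have "c i \<in> mon_ideal (nfold_sums U (r * i))"
    using c[OF i(1)] unfolding ideal_power_mult[OF ideal_mon_ideal] by (simp only: ideal_power_mon_ideal)
  then obtain u where "u \<in> nfold_sums U (r * i)" "\<And>j. Poly_Mapping.lookup u j \<le> Poly_Mapping.lookup a j"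
    using a(1) by (auto simp: mon_ideal_def)
  ultimately have "fits U (r * i) (k * i)"
    unfolding fits_def by metis
  then show ?thesis using that i(1) by auto
qed

text \<open>The quotients converge along all \<open>q\<close>, and the powers of \<open>p\<close>
  form a subsequence.\<close>

lemma F_threshold_mon_ideal:
  fixes U :: "('n::finite \<Rightarrow>\<^sub>0 nat) set"
  assumes "1 < p" "0 \<notin> U"
    and opt: "fits U r0 k0" "0 < k0" "\<And>r k. fits U r k \<Longrightarrow> r * k0 \<le> r0 * k"
  shows "F_threshold p (mon_ideal U :: ('n, 'k::field) mvpoly set) = real r0 / real k0"
proof -
  let ?\<nu> = "nu (mon_ideal U :: ('n, 'k) mvpoly set)"
  have nu: "?\<nu> q = Max {r. fits U r (q - 1)}" if "0 < q" for q
    unfolding nu_def not_subset_frobenius_power_iff[OF that] ..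
  have "(\<lambda>q. real (Max {r. fits U r (q - 1)}) / real q) \<longlonglongrightarrow> real r0 / real k0"
    by (rule tendsto_growth_rate[where P = "fits U", OF fits_0 fits_add fits_mono fits_bound[OF assms(2)] opt])
  moreover have "filterlim (\<lambda>e. p ^ e) at_top sequentially"
    by (rule filterlim_subseq) (use assms(1) in \<open>simp add: strict_mono_def power_strict_increasing\<close>)
  ultimately have "(\<lambda>e. real (Max {r. fits U r (p ^ e - 1)}) / real (p ^ e)) \<longlonglongrightarrow> real r0 / real k0"
    by (rule filterlim_compose)
  moreover have "?\<nu> (p ^ e) = Max {r. fits U r (p ^ e - 1)}" for e
    using assms(1) by (intro nu) simp
  ultimately have "(\<lambda>e. real (?\<nu> (p ^ e)) / real (p ^ e)) \<longlonglongrightarrow> real r0 / real k0"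
    by (simp only:)
  then show ?thesis
    unfolding F_threshold_def by (rule limI)
qed

theorem theorem6p11:
  fixes \<aa> :: "('n::{finite,linorder}, 'k::field) mvpoly set"
    and p :: nat
  assumes "Factorial_Ring.prime p" and "CHAR('k) = p"
    and "monomial_ideal \<aa>" and "\<aa> \<noteq> {0}" and "\<aa> \<noteq> UNIV"
  shows "(\<forall>RV. rees_valuations \<aa> RV \<longrightarrow>
            F_threshold p \<aa> =
              Min ((\<lambda>v. real_of_int (v (to_fract (\<Prod>i\<in>UNIV. var i))) /
                        real_of_int (ideal_value v \<aa>)) ` RV))
         \<and> F_threshold p \<aa> \<in> \<rat>"
proof -
  obtain U where U: "\<aa> = mon_ideal U"
    using assms(3) by (auto simp: monomial_ideal_def genideal_monomial)
  have ideal: "ideal \<aa> type_ring"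
    unfolding U by (rule ideal_mon_ideal)
  have "0 \<notin> U"
  proof
    assume "0 \<in> U"
    then have "f \<in> \<aa>" for f
      unfolding U mon_ideal_def by (auto intro!: bexI[of _ 0])
    then have "\<aa> = UNIV" by blast
    with assms(5) show False ..
  qed
  then obtain r0 k0 where opt: "fits U r0 k0" "0 < k0" "\<And>r k. fits U r k \<Longrightarrow> r * k0 \<le> r0 * k"
    using fits_optimum by blast
  have F: "F_threshold p \<aa> = real r0 / real k0"
    unfolding U using F_threshold_mon_ideal[OF prime_gt_1_nat[OF assms(1)] \<open>0 \<notin> U\<close> opt] .
  have "F_threshold p \<aa> = Min ((\<lambda>v. real_of_int (v (to_fract (\<Prod>i\<in>UNIV. var i))) /
      real_of_int (ideal_value v \<aa>)) ` RV)" (is "_ = Min (?ratio ` RV)") if "rees_valuations \<aa> RV" for RV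
  proof -
    obtain Vs where Vs: "rees_valuation_rings \<aa> Vs" and RV: "RV = valuation_of ` Vs"
      using \<open>rees_valuations \<aa> RV\<close> by (auto simp: rees_valuations_def)
    note rees = rees_valuation_ringsD[OF Vs ideal assms(4,5)]
    let ?x = "\<Prod>i\<in>UNIV. var i :: ('n, 'k) mvpoly"
    have x0: "to_fract ?x \<noteq> 0"
      by (simp add: var_def)
    have v_pow: "v (to_fract (?x ^ k)) = int k * v (to_fract ?x)" and pos: "0 < ideal_value v \<aa>"
      if "v \<in> RV" for v k
    proof -
      obtain V where V: "V \<in> Vs" "v = valuation_of V" using \<open>v \<in> RV\<close> RV by blast
      interpret discrete_valuation V v unfolding V(2) by (rule rees(3)[OF V(1)])
      show "v (to_fract (?x ^ k)) = int k * v (to_fract ?x)" "0 < ideal_value v \<aa>"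
        using v_power[OF x0] rees(5)[OF V(1)] V(2) by (auto simp: to_fract_power)
    qed
    \<comment> \<open>Both inequalities pass through this equivalence: its right side says that r /
      k is at most every ratio of values.\<close>
    have closure: "?x ^ k \<in> integral_closure (ideal_power \<aa> r) \<longleftrightarrow>
        (\<forall>v\<in>RV. int r * ideal_value v \<aa> \<le> int k * v (to_fract ?x))" for r k
      using rees(6)[of "?x ^ k" r] x0 v_pow RV by auto
    have fin: "finite (?ratio ` RV)" "?ratio ` RV \<noteq> {}"
      using rees(1,2) RV by auto
    have "real r0 / real k0 \<le> ?ratio v" if v: "v \<in> RV" for v
    proof -
      have "?x ^ k0 \<in> integral_closure (ideal_power \<aa> r0)"
        unfolding prod_var_power
        using subset_integral_closure[OF ideal_ideal_power[OF ideal, of r0]] opt(1)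
        by (auto simp: U monomial_const_exponent_mem)
      then have "int r0 * ideal_value v \<aa> \<le> int k0 * v (to_fract ?x)"
        using closure v by blast
      then have "real_of_int (int r0 * ideal_value v \<aa>) \<le> real_of_int (int k0 * v (to_fract ?x))"
        by (simp only: of_int_le_iff)
      then show ?thesis using pos[OF v] opt(2) by (simp add: divide_simps mult.commute)
    qed
    then have ge: "real r0 / real k0 \<le> Min (?ratio ` RV)"
      using fin by simp
    moreover have "Min (?ratio ` RV) \<le> real r0 / real k0"
    proof (rule ccontr)
      assume "\<not> ?thesis"
      \<comment> \<open>A rational \<open>s\<close> strictly between the two sides is a ratio r / k
        satisfying all valuation inequalities. Then x ^ k is integral over the r-th power, and some
        multiple of (r, k) fits, although its ratio exceeds the optimum.\<close>
      then obtain s where s: "s \<in> \<rat>" "real r0 / real k0 < s" "s < Min (?ratio ` RV)"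
        using Rats_dense_in_real by (meson not_le)
      \<comment> \<open>Nonnegativity allows \<open>s\<close>, rather than its absolute value, to be
        written as a quotient of naturals.\<close>
      moreover have "0 \<le> s" using s(2) by (meson divide_nonneg_nonneg less_eq_real_def of_nat_0_le_iff order_trans)
      ultimately obtain r k where rk: "k \<noteq> 0" "s = real r / real k"
        using Rats_abs_nat_div_natE[of s] by (metis abs_of_nonneg)
      have "int r * ideal_value v \<aa> \<le> int k * v (to_fract ?x)" if v: "v \<in> RV" for v
      proof -
        have "real r / real k < ?ratio v"
          using s(3) fin v unfolding rk(2) by simp
        then have "real_of_int (int r * ideal_value v \<aa>) \<le> real_of_int (int k * v (to_fract ?x))"
          using pos[OF v] rk(1) by (simp add: divide_simps mult.commute)
        then show ?thesis by (simp only: of_int_le_iff)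
      qed
      then have "?x ^ k \<in> integral_closure (ideal_power \<aa> r)"
        using closure by blast
      then obtain i where i: "1 \<le> i" "fits U (r * i) (k * i)"
        unfolding prod_var_power U by (rule fits_if_integral)
      have "(r * k0) * i \<le> (r0 * k) * i"
        using opt(3)[OF i(2)] by (simp add: mult_ac)
      then have "r * k0 \<le> r0 * k" using i(1) by simp
      then have "real r * real k0 \<le> real r0 * real k"
        by (metis of_nat_le_iff of_nat_mult)
      then have "s \<le> real r0 / real k0"
        unfolding rk(2) using rk(1) opt(2) by (simp add: pos_divide_le_eq pos_le_divide_eq)
      then show False using s(2) by simp
    qed
    ultimately show ?thesis unfolding F by (rule antisym)
  qed
  moreover have "F_threshold p \<aa> \<in> \<rat>"
    unfolding F by simp
  ultimately show ?thesis by (intro conjI allI impI)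
qed

end
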